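(* For every $\varepsilon>0$ and positive integers $t,r$, if $n$ is large enough and $\mathcal F\subseteq 2^{[n]}$ has size at least $(t+\varepsilon)\binom{n}{\lfloor n/2\rfloor}$, then there exists $F\in\mathcal F$ such that $F$ is the bottom element of an induced copy of $\vee_{\delta n^t}$ in $\mathcal F$, where $\delta=\frac{\varepsilon}{2^{t+3}t!}$; that is, there exist at least $\delta n^t$ pairwise incomparable sets $G\in\mathcal F$ with $F\subsetneq G$.
   Context: $\vee_k$ is the poset with elements $a,b_1,\dots,b_k$, $a<b_j$ for all $j$, the $b_j$ pairwise incomparable. An induced copy of $\vee_k$ in $\mathcal F$ with bottom element $F$ consists of $F\in\mathcal F$ together with $k$ pairwise incomparable (under inclusion) sets of $\mathcal F$ each properly containing $F$. *)

theory Defs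
  imports Complex_Main
begin

(* F plays the least element a of the poset with a < b_1, ..., a < b_k and the b_j pairwise
   incomparable; the set \<G> is the image of {b_1, ..., b_k}. *)
definition induced_vee_bottom :: "nat \<Rightarrow> 'a set set \<Rightarrow> 'a set \<Rightarrow> bool" where
  "induced_vee_bottom k \<F> F \<longleftrightarrow>
     F \<in> \<F> \<and>
     (\<exists>\<G>. \<G> \<subseteq> \<F> \<and> finite \<G> \<and> card \<G> = k \<and>
        (\<forall>G\<in>\<G>. F \<subset> G) \<and>
        (\<forall>G\<in>\<G>. \<forall>H\<in>\<G>. G \<noteq> H \<longrightarrow> \<not> G \<subseteq> H \<and> \<not> H \<subseteq> G))"

end

theory Submission
  imports Defs "HOL-Probability.Hoeffding" "HOL-Real_Asymp.Real_Asymp"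
begin

text \<open>
  After discarding the sets whose size is far from \<open>n / 2\<close>, which are negligible by Hoeffding's
  inequality, a random maximal chain meets the family in at least \<open>t + \<epsilon> / 2\<close> sets on average.
  Conditioning on the lowest member of the family in the chain yields an \<open>F\<close> in the family such
  that a random maximal chain through \<open>F\<close> contains on average at least \<open>t + \<epsilon> / 2\<close> members above or
  equal to \<open>F\<close>. Each level contributes at most 1, so the levels at distance at least \<open>t\<close> from \<open>F\<close>
  contribute at least \<open>\<epsilon> / 2\<close>. If each of them contained fewer than \<open>\<delta> n ^ t\<close> sets, level \<open>t\<close> would
  contribute at most \<open>\<epsilon> / 4\<close>, and each higher one only \<open>O(1 / n)\<close>; as the window of sizes has
  width a small multiple of \<open>n\<close>, all of these together contribute at most \<open>\<epsilon> / 8\<close>. Hence some single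
  level, which is an antichain, is large.
\<close>

section \<open>Weights of random maximal chains\<close>

text \<open>The expected number of members of \<open>\<F>\<close> above or equal to \<open>A\<close> in a random maximal chain of
  subsets of \<open>U\<close> through \<open>A\<close>.\<close>

definition up_weight :: "'a set \<Rightarrow> 'a set set \<Rightarrow> 'a set \<Rightarrow> real" where
  "up_weight U \<F> A =
     (\<Sum>G\<in>{G \<in> \<F>. A \<subseteq> G}. 1 / real ((card U - card A) choose (card G - card A)))"

lemma inverse_binomial_absorb:
  assumes "0 < j" "j \<le> m"
  shows "real j / real ((m - 1) choose (j - 1)) = real m / real (m choose j)"
proof -
  have "j * (m choose j) = m * ((m - 1) choose (j - 1))"
    using assms times_binomial_minus1_eq by blast
  hence "real j * real (m choose j) = real m * real ((m - 1) choose (j - 1))"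
    by (metis of_nat_mult)
  moreover have "(m choose j) > 0" "((m - 1) choose (j - 1)) > 0"
    using assms by auto
  ultimately show ?thesis by (simp add: field_simps)
qed

text \<open>A random maximal chain through \<open>A\<close> next passes through
  \<open>insert x A\<close> with \<open>x\<close> uniform in \<open>U - A\<close>, and
  \<open>A\<close> itself is not counted, so its weight is the mean over its upper covers. In the
  double sum each \<open>G\<close> occurs once for every \<open>x\<close> in \<open>G - A\<close>,
  and \<open>inverse_binomial_absorb\<close> turns this multiplicity into the factor
  \<open>card U - card A\<close>.\<close>

lemma up_weight_average:
  assumes U: "finite U" and \<F>: "\<F> \<subseteq> Pow U" and A: "A \<subseteq> U" "A \<notin> \<F>"
  shows "(\<Sum>x\<in>U - A. up_weight U \<F> (insert x A)) = real (card U - card A) * up_weight U \<F> A"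
proof -
  have fA: "finite A" using U A finite_subset by blast
  have f\<F>: "finite \<F>" using U \<F> finite_subset by blast
  let ?m = "card U - card A"
  let ?g = "\<lambda>G. 1 / real ((?m - 1) choose (card G - card A - 1))"
  have "(\<Sum>x\<in>U - A. up_weight U \<F> (insert x A))
      = (\<Sum>x\<in>U - A. \<Sum>G\<in>{G \<in> {G \<in> \<F>. A \<subseteq> G}. x \<in> G}. ?g G)"
    unfolding up_weight_def using fA by (intro sum.cong) auto
  also have "\<dots> = (\<Sum>G\<in>{G \<in> \<F>. A \<subseteq> G}. \<Sum>x\<in>{x \<in> U - A. x \<in> G}. ?g G)"
    using U f\<F> by (intro sum.swap_restrict) auto
  also have "\<dots> = (\<Sum>G\<in>{G \<in> \<F>. A \<subseteq> G}. real ?m * (1 / real (?m choose (card G - card A))))"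
  proof (intro sum.cong refl)
    fix G assume G: "G \<in> {G \<in> \<F>. A \<subseteq> G}"
    \<comment> \<open>Since \<open>A \<notin> \<F>\<close>, the inclusion is strict, so the index is
      positive as absorption requires.\<close>
    hence GU: "G \<subseteq> U" and AG: "A \<subset> G" using \<F> A by auto
    have fG: "finite G" using GU U finite_subset by blast
    have "{x \<in> U - A. x \<in> G} = G - A" using GU by auto
    hence "card {x \<in> U - A. x \<in> G} = card G - card A"
      using AG fA by (simp add: card_Diff_subset)
    moreover have "card A < card G" "card G \<le> card U"
      using AG GU fG U by (auto intro: psubset_card_mono card_mono)
    ultimately show "(\<Sum>x\<in>{x \<in> U - A. x \<in> G}. ?g G)
        = real ?m * (1 / real (?m choose (card G - card A)))"
      using inverse_binomial_absorb[of "card G - card A" ?m] by simp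
  qed
  also have "\<dots> = real ?m * up_weight U \<F> A"
    unfolding up_weight_def by (simp only: sum_distrib_left)
  finally show ?thesis .
qed

text \<open>Downward induction on \<open>A\<close>, replacing the conditioning on the lowest member of a chain.\<close>

lemma up_weight_less:
  assumes U: "finite U" and \<F>: "\<F> \<subseteq> Pow U" and "0 < s"
    and mem: "\<And>F. F \<in> \<F> \<Longrightarrow> up_weight U \<F> F < s"
    and A: "A \<subseteq> U"
  shows "up_weight U \<F> A < s"
  using A
proof (induction "card U - card A" arbitrary: A rule: less_induct)
  case less
  have fA: "finite A" using U less.prems finite_subset by blast
  consider "A \<in> \<F>" | "A \<notin> \<F>" "A = U" | "A \<notin> \<F>" "A \<subset> U" using less.prems by auto
  thus ?case
  proof cases
    case 1
    thus ?thesis by (rule mem)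
  next
    case 2
    hence "{G \<in> \<F>. A \<subseteq> G} = {}" using \<F> by auto
    thus ?thesis unfolding up_weight_def using \<open>0 < s\<close> by (simp only: sum.empty)
  next
    case 3
    have c: "card A < card U" using 3 U by (simp add: psubset_card_mono)
    have ne: "U - A \<noteq> {}" using 3 by auto
    have "up_weight U \<F> (insert x A) < s" if "x \<in> U - A" for x
      using that less.prems c fA by (intro less.hyps) auto
    hence "(\<Sum>x\<in>U - A. up_weight U \<F> (insert x A)) < (\<Sum>x\<in>U - A. s)"
      using ne U by (intro sum_strict_mono) auto
    also have "\<dots> = real (card U - card A) * s"
      using 3 fA by (simp add: card_Diff_subset)
    finally show ?thesis
      using up_weight_average[OF U \<F> less.prems 3(1)] c by simp
  qed
qed

section \<open>Counting supersets and estimating binomial coefficients\<close>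

lemma card_supersets_of_card:
  assumes U: "finite U" and F: "F \<subseteq> U"
  shows "card {G. F \<subseteq> G \<and> G \<subseteq> U \<and> card G = card F + j} = (card U - card F) choose j"
proof -
  have fF: "finite F" using F U finite_subset by blast
  let ?\<B> = "{B. B \<subseteq> U - F \<and> card B = j}"
  let ?\<G> = "{G. F \<subseteq> G \<and> G \<subseteq> U \<and> card G = card F + j}"
  have into: "F \<union> B \<in> ?\<G>" if "B \<in> ?\<B>" for B
  proof -
    have "finite B" using that U finite_subset[of B "U - F"] by simp
    hence "card (F \<union> B) = card F + card B" using that fF by (intro card_Un_disjoint) auto
    moreover have "F \<union> B \<subseteq> U" using that F by blast
    ultimately show ?thesis using that by simp
  qed
  have restrict: "G - F \<in> ?\<B>" if "G \<in> ?\<G>" for G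
  proof -
    have "card (G - F) = j" using that fF by (simp add: card_Diff_subset)
    thus ?thesis using that by blast
  qed
  have "bij_betw (\<lambda>B. F \<union> B) ?\<B> ?\<G>"
  proof (rule bij_betwI[where g = "\<lambda>G. G - F"])
    show "(\<lambda>B. F \<union> B) \<in> ?\<B> \<rightarrow> ?\<G>" using into by (rule Pi_I)
    show "(\<lambda>G. G - F) \<in> ?\<G> \<rightarrow> ?\<B>" using restrict by (rule Pi_I)
  qed blast+
  hence "card {G. F \<subseteq> G \<and> G \<subseteq> U \<and> card G = card F + j} = card {B. B \<subseteq> U - F \<and> card B = j}"
    by (simp add: bij_betw_same_card)
  also have "\<dots> = (card U - card F) choose j"
    using U F fF by (simp add: n_subsets card_Diff_subset)
  finally show ?thesis .
qed

text \<open>The smallest of the \<open>k\<close> factors of the falling factorial of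
  \<open>m\<close> is \<open>m - k + 1\<close>, which is still at least \<open>y\<close>.\<close>

lemma pow_div_fact_le_binomial:
  assumes "0 \<le> y" "y + real k \<le> real m + 1"
  shows "y ^ k / fact k \<le> real (m choose k)"
proof -
  have "y ^ k = (\<Prod>i<k. y)" by simp
  also have "\<dots> \<le> (\<Prod>i<k. real m - real i)"
  proof (intro prod_mono conjI)
    fix i assume "i \<in> {..<k}"
    hence "real i + 1 \<le> real k" by simp
    thus "y \<le> real m - real i" using assms(2) by linarith
  qed (rule assms(1))
  also have "\<dots> = fact k * (real m gchoose k)"
    by (simp add: gbinomial_prod_rev atLeast0LessThan)
  also have "real m gchoose k = real (m choose k)" by (simp add: binomial_gbinomial)
  finally show ?thesis by (simp add: field_simps)
qed

text \<open>The size of a uniformly random subset of \<open>U\<close> is binomial with parameter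
  1/2, so the count is \<open>2 ^ n\<close> times a tail probability, to which Hoeffding's
  inequality applies.\<close>

lemma binomial_tail_card:
  assumes U: "finite U" "card U = n" and "0 < n" and "0 \<le> \<eta>"
  shows "real (card {A \<in> Pow U. \<bar>real (card A) - real n / 2\<bar> \<ge> \<eta> * real n})
     \<le> 2 ^ n * (2 * exp (- 2 * \<eta>\<^sup>2 * real n))"
proof -
  let ?P = "\<lambda>k. \<bar>real k - real n / 2\<bar> \<ge> \<eta> * real n"
  interpret binomial_distribution n "1/2" by unfold_locales auto
  have "{A \<in> Pow U. ?P (card A)} = (\<Union>k\<in>{k\<in>{..n}. ?P k}. {A. A \<subseteq> U \<and> card A = k})"
    using U by (auto simp: card_mono)
  hence "card {A \<in> Pow U. ?P (card A)} = (\<Sum>k\<in>{k\<in>{..n}. ?P k}. card {A. A \<subseteq> U \<and> card A = k})"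
    using U by (simp, intro card_UN_disjoint) auto
  also have "\<dots> = (\<Sum>k\<in>{k\<in>{..n}. ?P k}. n choose k)"
    using U by (simp add: n_subsets)
  finally have c: "real (card {A \<in> Pow U. ?P (card A)}) = (\<Sum>k\<in>{k\<in>{..n}. ?P k}. real (n choose k))"
    by simp
  have "(\<Sum>k\<in>{k\<in>{..n}. ?P k}. real (n choose k))
      = 2 ^ n * (\<Sum>k\<in>{k\<in>{..n}. ?P k}. pmf (binomial_pmf n (1/2)) k)"
    unfolding sum_distrib_left
    by (intro sum.cong) (auto simp: field_simps power_add[symmetric])
  also have "(\<Sum>k\<in>{k\<in>{..n}. ?P k}. pmf (binomial_pmf n (1/2)) k)
     = measure_pmf.prob (binomial_pmf n (1/2)) {k\<in>{..n}. ?P k}"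
    by (simp add: measure_measure_pmf_finite)
  also have "\<dots> \<le> measure_pmf.prob (binomial_pmf n (1/2)) {k. ?P k}"
    by (intro measure_pmf.finite_measure_mono) auto
  also have "\<dots> \<le> 2 * exp (- 2 * (\<eta> * real n)\<^sup>2 / real n)"
    using prob_abs_ge[of "\<eta> * real n"] assms by simp
  also have "- 2 * (\<eta> * real n)\<^sup>2 / real n = - 2 * \<eta>\<^sup>2 * real n"
    using assms by (simp add: power2_eq_square)
  finally show ?thesis using c by simp
qed


section \<open>Levels above a fixed set\<close>

definition up_level :: "'a set set \<Rightarrow> 'a set \<Rightarrow> nat \<Rightarrow> 'a set set" where
  "up_level \<F> F j = {G \<in> \<F>. F \<subseteq> G \<and> card G = card F + j}"

lemma up_weight_levels:
  assumes U: "finite U" and \<F>: "\<F> \<subseteq> Pow U"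
    and J: "\<And>G. G \<in> \<F> \<Longrightarrow> card G \<le> card F + J"
  shows "up_weight U \<F> F = (\<Sum>j\<le>J. real (card (up_level \<F> F j)) / real ((card U - card F) choose j))"
proof -
  let ?S = "{G \<in> \<F>. F \<subseteq> G}"
  have fS: "finite ?S" using U finite_subset[OF \<F>] by simp
  \<comment> \<open>Rules out truncated subtraction: without it \<open>card G - card F = 0\<close>
    would not force equal sizes.\<close>
  have card_le: "card F \<le> card G" if "G \<in> ?S" for G
  proof -
    have "G \<subseteq> U" using that \<F> by auto
    hence "finite G" using U finite_subset by auto
    thus ?thesis using that by (intro card_mono) auto
  qed
  have "up_weight U \<F> F =
      (\<Sum>j\<le>J. \<Sum>G\<in>{G \<in> ?S. card G - card F = j}. 1 / real ((card U - card F) choose (card G - card F)))"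
    unfolding up_weight_def
    using J by (intro sum.group[symmetric] fS) (auto simp: le_diff_conv add.commute)
  also have "\<dots> = (\<Sum>j\<le>J. \<Sum>G\<in>up_level \<F> F j. 1 / real ((card U - card F) choose j))"
  proof (intro sum.cong refl)
    fix j
    show "{G \<in> ?S. card G - card F = j} = up_level \<F> F j"
      unfolding up_level_def using card_le by force
  qed (auto simp: up_level_def)
  finally show ?thesis by simp
qed

lemma card_up_level_le:
  assumes "finite U" "\<F> \<subseteq> Pow U" "F \<subseteq> U"
  shows "card (up_level \<F> F j) \<le> (card U - card F) choose j"
proof -
  have "up_level \<F> F j \<subseteq> {G. F \<subseteq> G \<and> G \<subseteq> U \<and> card G = card F + j}"
    unfolding up_level_def using assms by auto
  moreover have "finite {G. F \<subseteq> G \<and> G \<subseteq> U \<and> card G = card F + j}"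
    using assms by (auto intro: finite_subset[of _ "Pow U"])
  ultimately show ?thesis using card_supersets_of_card[OF assms(1,3), of j] card_mono by fastforce
qed

text \<open>Two finite sets of equal size are incomparable unless equal, so each level is an
  antichain. Level 0 is \<open>{F}\<close> itself, whence \<open>0 < j\<close>.\<close>

lemma induced_vee_bottom_up_level:
  assumes "finite U" "\<F> \<subseteq> Pow U" "F \<in> \<F>" "0 < j"
  shows "induced_vee_bottom (card (up_level \<F> F j)) \<F> F"
  unfolding induced_vee_bottom_def
proof (intro conjI exI[of _ "up_level \<F> F j"] ballI impI)
  have fin: "finite G" if "G \<in> \<F>" for G using that assms finite_subset by blast
  show "finite (up_level \<F> F j)"
    unfolding up_level_def using assms(1) finite_subset[OF assms(2)] by simp
  show "F \<subset> G" if "G \<in> up_level \<F> F j" for G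
    using that \<open>0 < j\<close> unfolding up_level_def by auto
  fix G H assume "G \<in> up_level \<F> F j" "H \<in> up_level \<F> F j" "G \<noteq> H"
  thus "\<not> G \<subseteq> H" "\<not> H \<subseteq> G"
    using fin[of G] fin[of H] card_subset_eq[of G H] card_subset_eq[of H G]
    unfolding up_level_def by auto
qed (use assms in \<open>auto simp: up_level_def\<close>)

lemma induced_vee_bottom_mono:
  assumes "induced_vee_bottom k \<F> F" "\<F> \<subseteq> \<F>'"
  shows "induced_vee_bottom k \<F>' F"
proof -
  from assms(1) obtain \<G> where "F \<in> \<F>" "\<G> \<subseteq> \<F>" "finite \<G>" "card \<G> = k" "\<forall>G\<in>\<G>. F \<subset> G"
    "\<forall>G\<in>\<G>. \<forall>H\<in>\<G>. G \<noteq> H \<longrightarrow> \<not> G \<subseteq> H \<and> \<not> H \<subseteq> G"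
    unfolding induced_vee_bottom_def by (elim conjE exE)
  moreover from this(1,2) assms(2) have "F \<in> \<F>'" "\<G> \<subseteq> \<F>'" by auto
  ultimately show ?thesis unfolding induced_vee_bottom_def by (intro conjI exI[of _ \<G>])
qed

section \<open>Comparison with the central binomial coefficient\<close>

lemma power_two_le_central_binomial:
  "2 ^ n \<le> (real n + 1) * real (n choose (n div 2))"
proof -
  have "(2::nat) ^ n = (\<Sum>k\<le>n. n choose k)" by (simp add: choose_row_sum)
  also have "\<dots> \<le> (\<Sum>k\<le>n. n choose (n div 2))" by (intro sum_mono binomial_maximum)
  finally have "real (2 ^ n) \<le> real ((n + 1) * (n choose (n div 2)))"
    by (intro of_nat_mono) simp
  thus ?thesis by (simp add: algebra_simps)
qed

text \<open>Replacing \<open>2 ^ n\<close> by the central coefficient costs only a factor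
  \<open>n + 1\<close>, which the exponential decay absorbs.\<close>

lemma eventually_tail_le_central_binomial:
  assumes "0 < \<eta>" "0 < c"
  shows "\<forall>\<^sub>F n in sequentially.
    2 ^ n * (2 * exp (- 2 * \<eta>\<^sup>2 * real n)) \<le> c * real (n choose (n div 2))"
proof -
  have "0 < \<eta>\<^sup>2" using assms by simp
  hence "(\<lambda>n::nat. (real n + 1) * (2 * exp (- 2 * \<eta>\<^sup>2 * real n))) \<longlonglongrightarrow> 0"
    by real_asymp
  hence "\<forall>\<^sub>F n in sequentially. (real n + 1) * (2 * exp (- 2 * \<eta>\<^sup>2 * real n)) < c"
    using \<open>0 < c\<close> by (rule order_tendstoD(2))
  thus ?thesis
  proof eventually_elim
    case (elim n)
    have "2 ^ n * (2 * exp (- 2 * \<eta>\<^sup>2 * real n))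
       \<le> ((real n + 1) * real (n choose (n div 2))) * (2 * exp (- 2 * \<eta>\<^sup>2 * real n))"
      by (intro mult_right_mono power_two_le_central_binomial) simp
    also have "\<dots> = ((real n + 1) * (2 * exp (- 2 * \<eta>\<^sup>2 * real n))) * real (n choose (n div 2))"
      by simp
    also have "\<dots> \<le> c * real (n choose (n div 2))"
      using elim by (intro mult_right_mono) auto
    finally show ?case .
  qed
qed

text \<open>The averaging behind the LYM inequality: a random maximal chain meets \<open>G\<close>
  with probability one over \<open>card U choose card G\<close>, which is smallest in the middle
  layer.\<close>

lemma card_le_up_weight_empty:
  assumes U: "finite U" and \<F>: "\<F> \<subseteq> Pow U"
  shows "real (card \<F>) / real (card U choose (card U div 2)) \<le> up_weight U \<F> {}"
proof -
  have "real (card \<F>) / real (card U choose (card U div 2))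
      = (\<Sum>G\<in>\<F>. 1 / real (card U choose (card U div 2)))" by simp
  also have "\<dots> \<le> (\<Sum>G\<in>\<F>. 1 / real (card U choose card G))"
  proof (intro sum_mono divide_left_mono)
    fix G assume "G \<in> \<F>"
    hence "card G \<le> card U" using U \<F> by (auto intro: card_mono)
    thus "0 < real (card U choose (card U div 2)) * real (card U choose card G)" by simp
  qed (use binomial_maximum in auto)
  finally show ?thesis by (simp add: up_weight_def)
qed

section \<open>Numerical bound on level sizes\<close>

text \<open>Here \<open>a j\<close> stands for the size of level \<open>j\<close> above
  \<open>F\<close>, \<open>m\<close> for \<open>n - card F\<close>, and \<open>J\<close> for the
  width of the window of sizes. If every \<open>a j\<close> with \<open>j \<ge> t\<close> were below
  the target, the levels below \<open>t\<close>, at \<open>t\<close> and beyond \<open>t\<close>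
  would contribute at most \<open>t\<close>, \<open>\<epsilon> / 4\<close> and
  \<open>\<epsilon> / 8\<close>, in total less than \<open>t + \<epsilon> / 2\<close>.\<close>

lemma large_up_level:
  fixes \<epsilon> :: real and t n m J :: nat
  assumes "0 < \<epsilon>" "0 < t" and n: "8 * t * (t + 1) \<le> n"
    and m: "real n / 2 - real n / (8 * (real t + 1)) \<le> real m"
    and J: "real J \<le> real n / (4 * (real t + 1))"
    and a1: "\<And>j. a j \<le> real (m choose j)"
    and big: "real t + \<epsilon> / 2 \<le> (\<Sum>j\<le>J. a j / real (m choose j))"
  shows "\<exists>j\<ge>t. \<epsilon> / (2 ^ (t + 3) * fact t) * real n ^ t \<le> a j"
proof (rule ccontr)
  define D where "D = \<epsilon> / (2 ^ (t + 3) * fact t) * real n ^ t"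
  assume "\<not> ?thesis"
  hence small: "a j < D" if "t \<le> j" for j using that unfolding D_def by force
  have n': "8 * real t * (real t + 1) \<le> real n"
  proof -
    have "real (8 * t * (t + 1)) \<le> real n" using n by (rule of_nat_mono)
    thus ?thesis by (simp add: algebra_simps)
  qed
  have npos: "0 < real n" using n \<open>0 < t\<close> by (cases n) auto
  have D0: "0 \<le> D" unfolding D_def using \<open>0 < \<epsilon>\<close> by simp
  \<comment> \<open>Chosen so that Bernoulli's inequality gives
    \<open>(1 - \<kappa>) ^ (t + 1) \<ge> 1 / 2\<close>.\<close>
  define \<kappa> where "\<kappa> = 1 / (2 * (real t + 1))"
  have \<kappa>: "0 \<le> \<kappa>" "\<kappa> \<le> 1" unfolding \<kappa>_def by (auto simp: field_simps)
  \<comment> \<open>This is \<open>n / 2\<close> minus twice \<open>n / (8 * (t + 1))\<close>: one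
    copy pays for the deviation of \<open>m\<close> from \<open>n / 2\<close>, the other for
    \<open>t\<close>. Then \<open>y + k \<le> m + 1\<close> holds for all \<open>k\<close> up to
    \<open>t + 1\<close>.\<close>
  define y where "y = (1 - \<kappa>) * (real n / 2)"
  have y0: "0 \<le> y" unfolding y_def using \<kappa> by simp
  have "real t \<le> real n / (8 * (real t + 1))"
    using n' by (simp add: field_simps)
  moreover have "y = real n / 2 - 2 * (real n / (8 * (real t + 1)))"
    unfolding y_def \<kappa>_def by (simp add: field_simps)
  ultimately have ym: "y + real t \<le> real m" using m by linarith
  have half: "1 / 2 \<le> (1 - \<kappa>) ^ k" if "k \<le> t + 1" for k
  proof -
    have "1 / 2 = 1 + real (t + 1) * (- \<kappa>)" unfolding \<kappa>_def by (simp add: field_simps)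
    also have "\<dots> \<le> (1 + (- \<kappa>)) ^ (t + 1)" using \<kappa> by (intro Bernoulli_inequality) simp
    also have "\<dots> \<le> (1 - \<kappa>) ^ k" using \<kappa> power_decreasing[OF that, of "1 - \<kappa>"] by simp
    finally show ?thesis .
  qed
  have lower: "(real n / 2) ^ k / (2 * fact k) \<le> real (m choose k)" if "k \<le> t + 1" for k
  proof -
    have "(1/2) * (real n / 2) ^ k \<le> (1 - \<kappa>) ^ k * (real n / 2) ^ k"
      by (intro mult_right_mono half that) simp
    hence "(1/2) * (real n / 2) ^ k / fact k \<le> y ^ k / fact k"
      unfolding y_def by (subst power_mult_distrib) (intro divide_right_mono, auto)
    also have "\<dots> \<le> real (m choose k)"
      using y0 ym that by (intro pow_div_fact_le_binomial) auto
    finally show ?thesis by simp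
  qed
  have div_lower: "D / real (m choose k) \<le> D / ((real n / 2) ^ k / (2 * fact k))"
    if "k \<le> t + 1" for k
  proof (rule divide_left_mono[OF lower[OF that] D0])
    have pos: "0 < (real n / 2) ^ k / (2 * fact k)" using npos by simp
    show "0 < real (m choose k) * ((real n / 2) ^ k / (2 * fact k))"
      by (rule mult_pos_pos[OF less_le_trans[OF pos lower[OF that]] pos])
  qed
  \<comment> \<open>The constant 8 in the denominator of \<open>D\<close> shows here: a factor 2 is
    lost in \<open>lower\<close>, leaving \<open>\<epsilon> / 4\<close>.\<close>
  have pt: "D / real (m choose t) \<le> \<epsilon> / 4"
  proof -
    have "D / real (m choose t) \<le> D / ((real n / 2) ^ t / (2 * fact t))"
      by (rule div_lower) simp
    also have "\<dots> = \<epsilon> / 4"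
      unfolding D_def using npos by (simp add: field_simps power_add)
    finally show ?thesis .
  qed
  have pt1: "D / real (m choose (t + 1)) \<le> \<epsilon> * (real t + 1) / (2 * real n)"
  proof -
    have "D / real (m choose (t + 1)) \<le> D / ((real n / 2) ^ (t + 1) / (2 * fact (t + 1)))"
      by (rule div_lower) simp
    also have "\<dots> = \<epsilon> * (real t + 1) / (2 * real n)"
      unfolding D_def using npos by (simp add: field_simps power_add)
    finally show ?thesis .
  qed
  have J8: "real J \<le> real n / 8"
  proof -
    have "real n / (4 * (real t + 1)) \<le> real n / 8"
      using npos \<open>0 < t\<close> by (intro divide_left_mono) auto
    thus ?thesis using J by linarith
  qed
  have m4: "real n / 4 \<le> real m"
  proof -
    have "real n / (8 * (real t + 1)) \<le> real n / 8"
      using npos by (intro divide_left_mono) auto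
    thus ?thesis using m npos by linarith
  qed
  \<comment> \<open>All levels up to \<open>J\<close> lie in the increasing half of row
    \<open>m\<close>, so beyond \<open>t\<close> the smallest denominator is
    \<open>m choose (t + 1)\<close>.\<close>
  have Jm: "2 * J \<le> m" using J8 m4 by linarith
  have le1: "a j / real (m choose j) \<le> 1" if "j \<le> J" for j
    using a1[of j] Jm that by (auto simp: divide_le_eq)
  have upper: "a j / real (m choose j) \<le> \<epsilon> * (real t + 1) / (2 * real n)"
    if j: "t + 1 \<le> j" "j \<le> J" for j
  proof -
    have "m choose (t + 1) \<le> m choose j" using j Jm by (intro binomial_mono) auto
    hence "D / real (m choose j) \<le> D / real (m choose (t + 1))"
      using D0 j Jm by (intro divide_left_mono mult_pos_pos) auto
    moreover have "a j / real (m choose j) \<le> D / real (m choose j)"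
      using small[of j] j by (intro divide_right_mono) auto
    ultimately show ?thesis using pt1 by linarith
  qed
  have at_t: "a t / real (m choose t) \<le> \<epsilon> / 4"
  proof -
    have "a t / real (m choose t) \<le> D / real (m choose t)"
      using small[of t] by (intro divide_right_mono) auto
    thus ?thesis using pt by linarith
  qed
  define c where "c = \<epsilon> * (real t + 1) / (2 * real n)"
  have c0: "0 \<le> c" unfolding c_def using \<open>0 < \<epsilon>\<close> by simp
  let ?f = "\<lambda>j. if j < t then 1 else 0 :: real"
  let ?g = "\<lambda>j. if j = t then \<epsilon> / 4 else 0"
  let ?h = "\<lambda>j. if t < j then c else 0"
  have "(\<Sum>j\<le>J. a j / real (m choose j)) \<le> (\<Sum>j\<le>J. ?f j + ?g j + ?h j)"
  proof (intro sum_mono)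
    fix j assume "j \<in> {..J}"
    hence j: "j \<le> J" by simp
    consider "j < t" | "j = t" | "t < j" by linarith
    thus "a j / real (m choose j) \<le> ?f j + ?g j + ?h j"
    proof cases
      case 1
      thus ?thesis using le1[OF j] by simp
    next
      case 2
      have "?f j + ?g j + ?h j = \<epsilon> / 4" using 2 by simp
      thus ?thesis using at_t 2 by (simp only:)
    next
      case 3
      have "?f j + ?g j + ?h j = c" using 3 by simp
      moreover have "a j / real (m choose j) \<le> c" unfolding c_def using upper[OF _ j] 3 by simp
      ultimately show ?thesis by (simp only:)
    qed
  qed
  also have "\<dots> = sum ?f {..J} + sum ?g {..J} + sum ?h {..J}"
    by (simp only: sum.distrib)
  also have "\<dots> \<le> real t + \<epsilon> / 4 + \<epsilon> / 8"
  proof (intro add_mono)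
    have "sum ?f {..J} = real (card ({..J} \<inter> {j. j < t}))" by (simp add: sum.If_cases)
    moreover have "card ({..J} \<inter> {j. j < t}) \<le> card {..<t}" by (intro card_mono) auto
    ultimately show "sum ?f {..J} \<le> real t" by simp
    show "sum ?g {..J} \<le> \<epsilon> / 4" using \<open>0 < \<epsilon>\<close> by simp
    have "sum ?h {..J} = real (card ({..J} \<inter> {j. t < j})) * c" by (simp add: sum.If_cases)
    moreover have "card ({..J} \<inter> {j. t < j}) \<le> card {1..J}" by (intro card_mono) auto
    ultimately have "sum ?h {..J} \<le> real J * c" using c0 by (simp add: mult_right_mono)
    \<comment> \<open>The number of levels is linear in \<open>n\<close> and \<open>c\<close> is of
      order \<open>1 / n\<close>, so both \<open>n\<close> and \<open>t + 1\<close> cancel.\<close>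
    also have "\<dots> \<le> real n / (4 * (real t + 1)) * c" using J c0 by (rule mult_right_mono)
    also have "\<dots> = \<epsilon> / 8"
    proof -
      have "(p::real) / (4 * q) * (\<epsilon> * q / (2 * p)) = \<epsilon> / 8" if "p \<noteq> 0" "q \<noteq> 0" for p q
        using that by (simp add: divide_simps)
      from this[of "real n" "real t + 1"] show ?thesis unfolding c_def using npos by simp
    qed
    finally show "sum ?h {..J} \<le> \<epsilon> / 8" .
  qed
  finally show False using big \<open>0 < \<epsilon>\<close> by linarith
qed

section \<open>Trimming the family and combining the estimates\<close>

theorem theorem2p5:
  fixes \<epsilon> :: real and t r :: nat
  assumes "\<epsilon> > 0" and "t > 0" and "r > 0"
  shows "\<exists>N. \<forall>n\<ge>N. \<forall>\<F> :: nat set set.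
           \<F> \<subseteq> Pow {1..n} \<longrightarrow>
           real (card \<F>) \<ge> (real t + \<epsilon>) * real (n choose (n div 2)) \<longrightarrow>
           (\<exists>F\<in>\<F>. \<exists>k. real k \<ge> \<epsilon> / (2 ^ (t + 3) * fact t) * real n ^ t \<and>
              induced_vee_bottom k \<F> F)"
proof -
  \<comment> \<open>Sizes within \<open>\<eta> * n\<close> of \<open>n / 2\<close> differ by at most
    \<open>2 * \<eta> * n = n / (4 * (t + 1))\<close>, the bound on \<open>J\<close> in
    \<open>large_up_level\<close>.\<close>
  define \<eta> where "\<eta> = 1 / (8 * (real t + 1))"
  have \<eta>: "0 < \<eta>" unfolding \<eta>_def by simp
  obtain N where N: "\<And>n. N \<le> n \<Longrightarrow>
      2 ^ n * (2 * exp (- 2 * \<eta>\<^sup>2 * real n)) \<le> \<epsilon> / 2 * real (n choose (n div 2))"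
    using eventually_tail_le_central_binomial[OF \<eta>, of "\<epsilon> / 2"] \<open>\<epsilon> > 0\<close>
    unfolding eventually_sequentially by auto
  show ?thesis
  \<comment> \<open>\<open>N\<close> makes the discarded tail cost at most
    \<open>\<epsilon> / 2\<close>; the other bound on \<open>n\<close> says
    \<open>t \<le> \<eta> * n\<close>.\<close>
  proof (intro exI[of _ "max N (8 * t * (t + 1))"] allI impI)
    fix n and \<F> :: "nat set set"
    assume n: "max N (8 * t * (t + 1)) \<le> n" and \<F>: "\<F> \<subseteq> Pow {1..n}"
      and size: "(real t + \<epsilon>) * real (n choose (n div 2)) \<le> real (card \<F>)"
    have npos: "0 < n" using n \<open>t > 0\<close> by (cases n) auto
    define T where "T = {A \<in> Pow {1..n}. \<bar>real (card A) - real n / 2\<bar> \<ge> \<eta> * real n}"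
    define \<F>' where "\<F>' = \<F> - T"
    have \<F>': "\<F>' \<subseteq> Pow {1..n}" using \<F> unfolding \<F>'_def by auto
    have window: "\<bar>real (card G) - real n / 2\<bar> < \<eta> * real n" if "G \<in> \<F>'" for G
      using that \<F> unfolding \<F>'_def T_def by force
    have "real (card T) \<le> \<epsilon> / 2 * real (n choose (n div 2))"
      using binomial_tail_card[of "{1..n}" n \<eta>] N[of n] n npos \<eta> unfolding T_def by force
    moreover have "finite T" unfolding T_def by simp
    hence "card \<F> - card T \<le> card \<F>'" unfolding \<F>'_def by (rule diff_card_le_card_Diff)
    hence "real (card \<F>) - real (card T) \<le> real (card \<F>')" by linarith
    ultimately have "(real t + \<epsilon> / 2) * real (n choose (n div 2)) \<le> real (card \<F>')"
      using size by (simp add: algebra_simps)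
    hence "real t + \<epsilon> / 2 \<le> real (card \<F>') / real (n choose (n div 2))"
      by (simp add: le_divide_eq)
    also have "\<dots> \<le> up_weight {1..n} \<F>' {}"
      using card_le_up_weight_empty[OF _ \<F>'] by simp
    \<comment> \<open>Contraposition of \<open>up_weight_less\<close> at the empty set: if all
      members of \<open>\<F>'\<close> had weight below \<open>t + \<epsilon> / 2\<close>, so would
      the empty set.\<close>
    finally have "\<not> up_weight {1..n} \<F>' {} < real t + \<epsilon> / 2" by simp
    then obtain F where F: "F \<in> \<F>'" "real t + \<epsilon> / 2 \<le> up_weight {1..n} \<F>' F"
      using up_weight_less[OF _ \<F>', of "real t + \<epsilon> / 2" "{}"] \<open>\<epsilon> > 0\<close> by force
    have FU: "F \<subseteq> {1..n}" using F \<F>' by auto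
    define J where "J = nat \<lfloor>2 * \<eta> * real n\<rfloor>"
    have J: "real J \<le> 2 * \<eta> * real n" unfolding J_def using \<eta> by simp
    have cJ: "card G \<le> card F + J" if "G \<in> \<F>'" for G
    proof -
      have "real (card G) - real (card F) \<le> 2 * \<eta> * real n"
        using window[OF that] window[OF F(1)] by linarith
      hence "int (card G) - int (card F) \<le> \<lfloor>2 * \<eta> * real n\<rfloor>" by (simp add: le_floor_iff)
      thus ?thesis unfolding J_def by linarith
    qed
    have "\<exists>j\<ge>t. \<epsilon> / (2 ^ (t + 3) * fact t) * real n ^ t \<le> real (card (up_level \<F>' F j))"
    proof (rule large_up_level[where m = "n - card F" and J = J])
      have "card F \<le> n" using card_mono[OF _ FU] by simp
      thus "real n / 2 - real n / (8 * (real t + 1)) \<le> real (n - card F)"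
        using window[OF F(1)] unfolding \<eta>_def by (simp add: of_nat_diff)
      have "2 * \<eta> * real n = real n / (4 * (real t + 1))"
        unfolding \<eta>_def by (simp add: field_simps)
      thus "real J \<le> real n / (4 * (real t + 1))" using J by simp
      show "real (card (up_level \<F>' F j)) \<le> real ((n - card F) choose j)" for j
        using card_up_level_le[OF _ \<F>' FU] by simp
      show "real t + \<epsilon> / 2 \<le> (\<Sum>j\<le>J. real (card (up_level \<F>' F j)) / real ((n - card F) choose j))"
        using F(2) up_weight_levels[OF _ \<F>' cJ] by simp
    qed (use assms n in auto)
    then obtain j where j: "t \<le> j"
      "\<epsilon> / (2 ^ (t + 3) * fact t) * real n ^ t \<le> real (card (up_level \<F>' F j))" by auto
    have "induced_vee_bottom (card (up_level \<F>' F j)) \<F>' F"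
      using induced_vee_bottom_up_level[OF _ \<F>' F(1), of j] j \<open>t > 0\<close> by simp
    hence vee: "induced_vee_bottom (card (up_level \<F>' F j)) \<F> F"
      by (rule induced_vee_bottom_mono) (auto simp: \<F>'_def)
    have "F \<in> \<F>" using F(1) unfolding \<F>'_def by simp
    with vee j(2) show "\<exists>F\<in>\<F>. \<exists>k. real k \<ge> \<epsilon> / (2 ^ (t + 3) * fact t) * real n ^ t \<and> induced_vee_bottom k \<F> F"
      by (intro bexI[of _ F] exI conjI)
  qed
qed

end
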